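(* Let $n$ be a positive integer, let $v=4n+2$, and let $X$ be a $v$-set partitioned into two subsets $\{a_0,a_1,\dots,a_{2n}\}$ and $\{b_0,b_1,\dots,b_{2n}\}$ (each of size $2n+1$). (i) Suppose $2n+1\equiv 1,3\pmod 6$. Let $\mathrm{STS}(2n+1)$ be a Steiner triple system on the point set $\{a_0,\dots,a_{2n}\}$, where the block $a_{\beta_0}a_{\beta_1}a_{\beta_2}$ is written via its indices as $\beta_0\beta_1\beta_2$. Then $$h_1=\sum_{\beta_0\beta_1\beta_2\in \mathrm{STS}(2n+1)} T(a_{\beta_0}b_{\beta_0},\,a_{\beta_1}b_{\beta_1},\,a_{\beta_2}b_{\beta_2},\,a_{\beta_0}b_{\beta_0})$$ is a $\mathrm{T}(2,3,4n+2)$ trade with volume $2\binom{2n+1}{2}$. (ii) Suppose $2n+1\equiv 5\pmod 6$. Let $\mathrm{STS}(2n-1)$ be a Steiner triple system on the point set $\{a_0,\dots,a_{2n-2}\}$, with blocks again written via their indices, and let $S$ be a partition of $\{a_0,\dots,a_{2n-3}\}$ into $2$-subsets. Then $$\begin{aligned} h_2=&\sum_{\beta_0\beta_1\beta_2\in \mathrm{STS}(2n-1)} T(a_{\beta_0}b_{\beta_0},\,a_{\beta_1}b_{\beta_1},\,a_{\beta_2}b_{\beta_2},\,a_{\beta_0}b_{\beta_0})\\ &+T(a_{2n-2}b_{2n-2},\,a_{2n-1}b_{2n-1},\,a_{2n}b_{2n},\,a_{2n-2}b_{2n-2})\\ &+\sum_{a_ia_j\in S} T(a_{2n-1}b_{2n-1},\,a_ib_i,\,a_{2n}b_{2n},\,a_jb_j,\,a_{2n-1}b_{2n-1})\end{aligned}$$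 is a $\mathrm{T}(2,3,4n+2)$ trade with volume $2\binom{2n+1}{2}$. (In both parts, the order in which the elements of each block of the Steiner triple system, or of each pair of $S$, are listed is arbitrary but fixed.)
   Context: Let $X$ be a $v$-set and let $\binom{X}{i}$ denote the set of $i$-subsets of $X$. Elements of $\binom{X}{k}$ are called blocks. A set $\{x_0,\dots,x_i\}$ is written as the string $x_0\cdots x_i$. A function $f:\binom{X}{k}\to\mathbb{Z}$ is identified with the formal $\mathbb{Z}$-linear combination of blocks $\sum_{B} f(B)\,B$. Trades. For integers $0\le t\le k\le v-t$, a $\mathrm{T}(t,k,v)$ trade is a function $f:\binom{X}{k}\to\mathbb{Z}$ such that for every $A\in\binom{X}{t}$, $\sum_{B\in\binom{X}{k},\,A\subseteq B} f(B)=0$. Write $f=f_0-f_1$ with $f_0=\max(f,0)$ and $f_1=\max(-f,0)$ (the two legs). The volume of the trade is $\sum_B f_0(B)=\sum_B f_1(B)$ (the number of blocks, counted with multiplicity, in each leg). Steiner triple systems. An $\mathrm{STS}(m)$ on an $m$-set $Y$ is a set of $3$-subsets (blocks) of $Y$ such that every $2$-subset of $Y$ is contained in exactly one block. It exists if and only if $m\equiv 1,3\pmod 6$. The trades $T(\mathcal{C})$. Products of distinct points denote the block consisting of these points, and products with sums are expanded multilinearly. Given a cycle $\mathcal{C}=(a_{i_0}b_{i_0},a_{i_1}b_{i_1},\dots,a_{i_m}b_{i_m})$ with $i_m=i_0$ in the complete graph whose vertices are the pairs $a_0b_0,\dots,a_{2n}b_{2n}$, define $$T(\mathcal{C})=T(a_{i_0}b_{i_0},\dots,a_{i_m}b_{i_m}):=\sum_{(a_ib_i,\,a_jb_j)\in\mathcal{C}}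 \Big(a_ib_i(a_j+b_j)-a_jb_j(a_i+b_i)\Big),$$ where the sum is over the edges of $\mathcal{C}$ directed in the order in which $\mathcal{C}$ traverses them, i.e. over the consecutive pairs $(i,j)=(i_s,i_{s+1})$, $0\le s<m$. *)

theory Defs
  imports Main "HOL-Library.Poly_Mapping" "HOL-Library.Ramsey" "HOL-Library.Disjoint_Sets"
begin

text \<open>
  The $i$-subsets of $X$ are \<open>nsets X i\<close>.  An integer-valued function on the $k$-subsets of the
  finite set $X$, identified with a formal linear combination of blocks, is an element of the free
  abelian group \<open>'a set \<Rightarrow>\<^sub>0 int\<close> supported on \<open>nsets X k\<close>; the block $B$ itself is \<open>frag_of B\<close>.
\<close>

definition is_trade :: "nat \<Rightarrow> nat \<Rightarrow> nat \<Rightarrow> 'a set \<Rightarrow> ('a set \<Rightarrow>\<^sub>0 int) \<Rightarrow> bool" where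
  "is_trade t k v X f \<longleftrightarrow>
     finite X \<and> card X = v \<and> t \<le> k \<and> k + t \<le> v \<and>
     Poly_Mapping.keys f \<subseteq> nsets X k \<and>
     (\<forall>A \<in> nsets X t. (\<Sum>B \<in> {B \<in> nsets X k. A \<subseteq> B}. Poly_Mapping.lookup f B) = 0)"

definition leg0 :: "('a set \<Rightarrow>\<^sub>0 int) \<Rightarrow> ('a set \<Rightarrow>\<^sub>0 int)" where
  "leg0 f = Poly_Mapping.map (\<lambda>c. max c 0) f"

definition leg1 :: "('a set \<Rightarrow>\<^sub>0 int) \<Rightarrow> ('a set \<Rightarrow>\<^sub>0 int)" where
  "leg1 f = Poly_Mapping.map (\<lambda>c. max (- c) 0) f"

definition has_volume :: "('a set \<Rightarrow>\<^sub>0 int) \<Rightarrow> nat \<Rightarrow> bool" where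
  "has_volume f V \<longleftrightarrow>
     (\<Sum>B \<in> Poly_Mapping.keys (leg0 f). Poly_Mapping.lookup (leg0 f) B) = int V \<and>
     (\<Sum>B \<in> Poly_Mapping.keys (leg1 f). Poly_Mapping.lookup (leg1 f) B) = int V"

definition is_STS :: "nat \<Rightarrow> 'a set \<Rightarrow> 'a set set \<Rightarrow> bool" where
  "is_STS m Y \<B> \<longleftrightarrow>
     finite Y \<and> card Y = m \<and> \<B> \<subseteq> nsets Y 3 \<and>
     (\<forall>P \<in> nsets Y 2. \<exists>!B. B \<in> \<B> \<and> P \<subseteq> B)"

text \<open>
  A vertex $a_i b_i$ is the ordered pair \<open>(a i, b i)\<close>.  For the directed edge from $x y$ to $z w$
  this is $xy(z+w) - zw(x+y)$, expanded; it is used only for four distinct points.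
\<close>

definition edge_term :: "'a \<times> 'a \<Rightarrow> 'a \<times> 'a \<Rightarrow> ('a set \<Rightarrow>\<^sub>0 int)" where
  "edge_term = (\<lambda>(x, y) (z, w).
     (frag_of {x, y, z} + frag_of {x, y, w}) - (frag_of {z, w, x} + frag_of {z, w, y}))"

text \<open>The list is the closed vertex sequence of the cycle, with its first vertex repeated at the end.\<close>

definition cycle_trade :: "('a \<times> 'a) list \<Rightarrow> ('a set \<Rightarrow>\<^sub>0 int)" where
  "cycle_trade C = (\<Sum>s < length C - 1. edge_term (C ! s) (C ! (s + 1)))"

end

theory Submission
  imports Defs
begin

text \<open>
  A 2-subset \<open>A\<close> has degree \<open>2[A = a\<^sub>ib\<^sub>i] - 2[A = a\<^sub>jb\<^sub>j]\<close> in the term of a directed edge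
  \<open>(a\<^sub>ib\<^sub>i, a\<^sub>jb\<^sub>j)\<close>, which telescopes to 0 along a closed walk.  Every block in that term meets
  exactly the pairs \<open>i\<close> and \<open>j\<close>, so edge-disjoint cycles have disjoint blocks and each edge adds
  2 to the volume.  In both parts the cycles decompose the complete graph on \<open>2n + 1\<close> vertices:
  the Steiner triples do so in (i); in (ii) the two extra vertices are joined to one vertex of the
  Steiner system by a triangle and to the other vertices by 4-cycles, one for each pair of \<open>S\<close>.
\<close>

section \<open>Volumes of functions with disjoint supports\<close>

lemma has_volume_iff:
  "has_volume f V \<longleftrightarrow>
     (\<Sum>B \<in> Poly_Mapping.keys f. max (Poly_Mapping.lookup f B) 0) = int V \<and>
     (\<Sum>B \<in> Poly_Mapping.keys f. max (- Poly_Mapping.lookup f B) 0) = int V"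
proof -
  \<comment> \<open>\<open>Poly_Mapping.map\<close> keeps zeros at zero whatever \<open>g 0\<close>
    is, and keys of \<open>f\<close> that \<open>g\<close> sends to 0 contribute nothing. So both
    legs can be summed over the keys of \<open>f\<close>.\<close>
  have map_sum: "(\<Sum>B \<in> Poly_Mapping.keys (Poly_Mapping.map g f).
      Poly_Mapping.lookup (Poly_Mapping.map g f) B) =
    (\<Sum>B \<in> Poly_Mapping.keys f. g (Poly_Mapping.lookup f B))" for g :: "int \<Rightarrow> int"
    by (rule sum.mono_neutral_cong_left) (auto simp: map.rep_eq in_keys_iff when_def)
  show ?thesis
    unfolding has_volume_def leg0_def leg1_def map_sum ..
qed

text \<open>Disjoint supports exclude cancellation: at each key only one summand is nonzero, so each
  leg of the sum is the disjoint union of the corresponding legs.\<close>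

lemma has_volume_add:
  assumes "has_volume f m" "has_volume g n" "Poly_Mapping.keys f \<inter> Poly_Mapping.keys g = {}"
  shows "has_volume (f + g) (m + n)"
proof -
  have g0: "Poly_Mapping.lookup g B = 0" if "B \<in> Poly_Mapping.keys f" for B
    using assms(3) that by (auto simp flip: not_in_keys_iff_lookup_eq_zero)
  have f0: "Poly_Mapping.lookup f B = 0" if "B \<in> Poly_Mapping.keys g" for B
    using assms(3) that by (auto simp flip: not_in_keys_iff_lookup_eq_zero)
  have keys: "Poly_Mapping.keys (f + g) = Poly_Mapping.keys f \<union> Poly_Mapping.keys g"
    using f0 g0 by (fastforce simp: in_keys_iff lookup_add)
  \<comment> \<open>An arbitrary \<open>u\<close> treats both legs at once; it is instantiated below
    with the positive and the negative part.\<close>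
  have "(\<Sum>B \<in> Poly_Mapping.keys (f + g). u (Poly_Mapping.lookup (f + g) B)) =
      (\<Sum>B \<in> Poly_Mapping.keys f. u (Poly_Mapping.lookup f B)) +
      (\<Sum>B \<in> Poly_Mapping.keys g. u (Poly_Mapping.lookup g B))" for u :: "int \<Rightarrow> int"
  proof -
    have "(\<Sum>B \<in> Poly_Mapping.keys f. u (Poly_Mapping.lookup (f + g) B)) =
        (\<Sum>B \<in> Poly_Mapping.keys f. u (Poly_Mapping.lookup f B))"
      by (intro sum.cong) (simp_all add: lookup_add g0)
    moreover have "(\<Sum>B \<in> Poly_Mapping.keys g. u (Poly_Mapping.lookup (f + g) B)) =
        (\<Sum>B \<in> Poly_Mapping.keys g. u (Poly_Mapping.lookup g B))"
      by (intro sum.cong) (simp_all add: lookup_add f0)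
    ultimately show ?thesis
      unfolding keys by (simp add: sum.union_disjoint assms(3))
  qed
  from this[of "\<lambda>c. max c 0"] this[of "\<lambda>c. max (- c) 0"] show ?thesis
    using assms(1,2) unfolding has_volume_iff by simp
qed

section \<open>Degrees of subsets, as additive functionals\<close>

definition block_degree :: "'a set \<Rightarrow> nat \<Rightarrow> 'a set \<Rightarrow> ('a set \<Rightarrow>\<^sub>0 int) \<Rightarrow> int" where
  "block_degree X k A f = (\<Sum>B \<in> {B \<in> nsets X k. A \<subseteq> B}. Poly_Mapping.lookup f B)"

lemma block_degree_add: "block_degree X k A (f + g) = block_degree X k A f + block_degree X k A g"
  by (simp add: block_degree_def lookup_add sum.distrib)

lemma block_degree_diff: "block_degree X k A (f - g) = block_degree X k A f - block_degree X k A g"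
  by (simp add: block_degree_def lookup_minus sum_subtractf)

lemma block_degree_zero: "block_degree X k A 0 = 0"
  by (simp add: block_degree_def)

lemma block_degree_sum: "block_degree X k A (sum f I) = (\<Sum>i\<in>I. block_degree X k A (f i))"
  by (induction I rule: infinite_finite_induct) (simp_all add: block_degree_add block_degree_zero)

lemma block_degree_frag_of:
  assumes "finite X" "T \<in> nsets X k"
  shows "block_degree X k A (frag_of T) = of_bool (A \<subseteq> T)"
proof -
  have "finite (nsets X k)"
    using assms(1) by (rule finite_imp_finite_nsets)
  then show ?thesis
    using assms(2) by (simp add: block_degree_def)
qed

section \<open>The term of one directed edge\<close>

lemma keys_edge_term:
  "Poly_Mapping.keys (edge_term (x, y) (z, w)) \<subseteq> {{x,y,z}, {x,y,w}, {z,w,x}, {z,w,y}}"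
proof -
  have "Poly_Mapping.keys (edge_term (x, y) (z, w)) \<subseteq>
     (Poly_Mapping.keys (frag_of {x,y,z}) \<union> Poly_Mapping.keys (frag_of {x,y,w})) \<union>
     (Poly_Mapping.keys (frag_of {z,w,x}) \<union> Poly_Mapping.keys (frag_of {z,w,y}))"
    unfolding edge_term_def prod.case
    by (intro order.trans[OF keys_diff] Un_mono keys_add)
  then show ?thesis by auto
qed

lemma nsets_3_insert:
  "x \<in> X \<Longrightarrow> y \<in> X \<Longrightarrow> z \<in> X \<Longrightarrow> distinct [x, y, z] \<Longrightarrow> {x, y, z} \<in> nsets X 3"
  by (auto simp: nsets_def)

text \<open>A mixed pair such as \<open>{x, z}\<close> lies in one positive block,
  \<open>{x, y, z}\<close>, and in one negative block, \<open>{z, w, x}\<close>, so it cancels. The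
  pair \<open>{x, y}\<close> lies in both positive blocks and in no negative one, and
  \<open>{z, w}\<close> the other way round.\<close>

lemma block_degree_edge_term:
  assumes "finite X" "{x, y, z, w} \<subseteq> X" "distinct [x, y, z, w]" "A \<in> nsets X 2"
  shows "block_degree X 3 A (edge_term (x, y) (z, w)) =
    2 * of_bool (A = {x, y}) - 2 * of_bool (A = {z, w})"
proof -
  obtain c d where "A = {c, d}" "c \<noteq> d"
    using assms(4) by (auto simp: nsets_def card_2_iff)
  have "{x,y,z} \<in> nsets X 3" "{x,y,w} \<in> nsets X 3" "{z,w,x} \<in> nsets X 3" "{z,w,y} \<in> nsets X 3"
    using assms(2,3) by (auto intro!: nsets_3_insert)
  then show ?thesis
    using \<open>A = {c, d}\<close> \<open>c \<noteq> d\<close> assms(1,3)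
    by (auto simp: edge_term_def block_degree_add block_degree_diff block_degree_frag_of
        doubleton_eq_iff)
qed

lemma neq_if_mem_diff: "x \<in> A \<Longrightarrow> x \<notin> B \<Longrightarrow> A \<noteq> B"
  by blast

lemma has_volume_edge_term:
  assumes "distinct [x, y, z, w]"
  shows "has_volume (edge_term (x, y) (z, w)) 2"
proof -
  let ?K = "{{x,y,z}, {x,y,w}, {z,w,x}, {z,w,y}}"
  \<comment> \<open>Each inequality is witnessed by a point of the first block missing from the
    second.\<close>
  have ne12: "{x,y,z} \<noteq> {x,y,w}"
    using assms by (intro neq_if_mem_diff[of z]) auto
  have ne13: "{x,y,z} \<noteq> {z,w,x}"
    using assms by (intro neq_if_mem_diff[of y]) auto
  have ne14: "{x,y,z} \<noteq> {z,w,y}"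
    using assms by (intro neq_if_mem_diff[of x]) auto
  have ne23: "{x,y,w} \<noteq> {z,w,x}"
    using assms by (intro neq_if_mem_diff[of y]) auto
  have ne24: "{x,y,w} \<noteq> {z,w,y}"
    using assms by (intro neq_if_mem_diff[of x]) auto
  have ne34: "{z,w,x} \<noteq> {z,w,y}"
    using assms by (intro neq_if_mem_diff[of x]) auto
  note ne = ne12 ne13 ne14 ne23 ne24 ne34
  have vals: "Poly_Mapping.lookup (edge_term (x, y) (z, w)) {x,y,z} = 1"
    "Poly_Mapping.lookup (edge_term (x, y) (z, w)) {x,y,w} = 1"
    "Poly_Mapping.lookup (edge_term (x, y) (z, w)) {z,w,x} = -1"
    "Poly_Mapping.lookup (edge_term (x, y) (z, w)) {z,w,y} = -1"
    by (simp_all add: edge_term_def lookup_minus lookup_add ne ne[symmetric])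
  \<comment> \<open>The condition \<open>u 0 = 0\<close> allows the sum to be extended from the keys
    to the explicit set \<open>?K\<close>, where all four values are known.\<close>
  have "(\<Sum>B \<in> Poly_Mapping.keys (edge_term (x, y) (z, w)).
      u (Poly_Mapping.lookup (edge_term (x, y) (z, w)) B)) = u 1 + u 1 + u (-1) + u (-1)"
    if "u 0 = 0" for u :: "int \<Rightarrow> int"
  proof -
    have "(\<Sum>B \<in> Poly_Mapping.keys (edge_term (x, y) (z, w)).
        u (Poly_Mapping.lookup (edge_term (x, y) (z, w)) B)) =
      (\<Sum>B \<in> ?K. u (Poly_Mapping.lookup (edge_term (x, y) (z, w)) B))"
      by (intro sum.mono_neutral_left ballI keys_edge_term) (simp_all only: finite.intros Diff_iff in_keys_iff not_not that)
    also have "\<dots> = u 1 + u 1 + u (-1) + u (-1)"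
      by (simp add: ne vals)
    finally show ?thesis .
  qed
  from this[of "\<lambda>c. max c 0"] this[of "\<lambda>c. max (- c) 0"] show ?thesis
    by (simp add: has_volume_iff)
qed

section \<open>The trade condition along closed walks\<close>

lemma is_trade_iff:
  "is_trade t k v X f \<longleftrightarrow>
     finite X \<and> card X = v \<and> t \<le> k \<and> k + t \<le> v \<and> Poly_Mapping.keys f \<subseteq> nsets X k \<and>
     (\<forall>A \<in> nsets X t. block_degree X k A f = 0)"
  by (simp add: is_trade_def block_degree_def)

lemma block_degree_cycle_trade:
  assumes "finite X" "A \<in> nsets X 2" "C ! 0 = C ! (length C - 1)"
    and "\<And>s. s < length C - 1 \<Longrightarrow>
      (case (C ! s, C ! Suc s) of ((x, y), (z, w)) \<Rightarrow> {x, y, z, w} \<subseteq> X \<and> distinct [x, y, z, w])"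
  shows "block_degree X 3 A (cycle_trade C) = 0"
proof -
  \<comment> \<open>\<open>g\<close> is a potential on vertices: every directed edge contributes the
    potential of its tail minus that of its head.\<close>
  define g :: "'a \<times> 'a \<Rightarrow> int" where "g p = 2 * of_bool (A = {fst p, snd p})" for p
  have "block_degree X 3 A (cycle_trade C) =
      (\<Sum>s < length C - 1. block_degree X 3 A (edge_term (C ! s) (C ! Suc s)))"
    by (simp add: cycle_trade_def block_degree_sum)
  also have "\<dots> = (\<Sum>s < length C - 1. g (C ! s) - g (C ! Suc s))"
  proof (rule sum.cong)
    fix s assume "s \<in> {..<length C - 1}"
    then show "block_degree X 3 A (edge_term (C ! s) (C ! Suc s)) = g (C ! s) - g (C ! Suc s)"
      using assms(4)[of s] block_degree_edge_term[OF assms(1) _ _ assms(2)]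
      by (cases "C ! s"; cases "C ! Suc s") (auto simp: g_def)
  qed simp
  also have "\<dots> = g (C ! 0) - g (C ! (length C - 1))"
    by (rule sum_lessThan_telescope')
  finally show ?thesis
    by (simp only: assms(3) diff_self)
qed

section \<open>Splitting a complete graph; for disjoint sets, \<open>join\<close> is the edge set of
  a complete bipartite graph\<close>

definition join :: "'i set \<Rightarrow> 'i set \<Rightarrow> 'i set set" where
  "join U W = {{u, w} |u w. u \<in> U \<and> w \<in> W}"

text \<open>The decomposition behind part (ii): \<open>insert x K\<close> carries the Steiner
  system, while \<open>y\<close> and \<open>z\<close> are the two extra vertices. The clique on
  \<open>insert x K\<close> and the triangle share only the vertex \<open>x\<close>, hence no edge;
  every remaining edge runs between \<open>K\<close> and \<open>{y, z}\<close>.\<close>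

lemma nsets_2_insert3:
  assumes "{x, y, z} \<inter> K = {}" "distinct [x, y, z]"
  shows "nsets (insert x K) 2 \<inter> nsets {x, y, z} 2 = {}"
    and "(nsets (insert x K) 2 \<union> nsets {x, y, z} 2) \<inter> join K {y, z} = {}"
    and "nsets (insert y (insert z (insert x K))) 2 =
      nsets (insert x K) 2 \<union> nsets {x, y, z} 2 \<union> join K {y, z}"
proof -
  have mem: "{u, w} \<in> nsets A 2 \<longleftrightarrow> u \<in> A \<and> w \<in> A \<and> u \<noteq> w" for u w :: 'a and A
    by (auto simp: nsets_def card_insert_if)
  show "nsets (insert x K) 2 \<inter> nsets {x, y, z} 2 = {}"
  proof (rule equals0I)
    fix P assume "P \<in> nsets (insert x K) 2 \<inter> nsets {x, y, z} 2"
    then have "P \<subseteq> {x}" "card P = 2"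
      using assms by (auto simp: nsets_def)
    then show False
      using card_mono[of "{x}" P] by simp
  qed
  show "(nsets (insert x K) 2 \<union> nsets {x, y, z} 2) \<inter> join K {y, z} = {}"
    using assms by (auto simp: join_def mem)
  show "nsets (insert y (insert z (insert x K))) 2 =
      nsets (insert x K) 2 \<union> nsets {x, y, z} 2 \<union> join K {y, z}"
  proof
    show "nsets (insert y (insert z (insert x K))) 2 \<subseteq>
      nsets (insert x K) 2 \<union> nsets {x, y, z} 2 \<union> join K {y, z}"
    proof
      fix P assume P: "P \<in> nsets (insert y (insert z (insert x K))) 2"
      then obtain u w where uw: "P = {u, w}"
        by (auto simp: nsets_2_eq)
      then have "u \<noteq> w" "u \<in> {x, y, z} \<union> K" "w \<in> {x, y, z} \<union> K"
        using P by (auto simp: mem)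
      moreover have "{u, w} \<in> join K {y, z}" if "u \<in> K \<and> w \<in> {y, z} \<or> w \<in> K \<and> u \<in> {y, z}"
        using that unfolding join_def by blast
      ultimately show "P \<in> nsets (insert x K) 2 \<union> nsets {x, y, z} 2 \<union> join K {y, z}"
        unfolding uw Un_iff mem by blast
    qed
    have "join K {y, z} \<subseteq> nsets (insert y (insert z (insert x K))) 2"
      using assms by (auto simp: join_def mem)
    then show "nsets (insert x K) 2 \<union> nsets {x, y, z} 2 \<union> join K {y, z} \<subseteq>
      nsets (insert y (insert z (insert x K))) 2"
      by (intro Un_least nsets_mono) auto
  qed
qed

section \<open>Point pairs as vertices of a graph\<close>

locale paired_points =
  fixes a b :: "'i \<Rightarrow> 'a" and V :: "'i set" and X :: "'a set"
  assumes finite_V: "finite V" and inj_a: "inj_on a V" and inj_b: "inj_on b V"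
    and disjoint: "a ` V \<inter> b ` V = {}" and X_eq: "X = a ` V \<union> b ` V"
begin

lemma finite_X: "finite X"
  using finite_V by (simp add: X_eq)

lemma a_eq_iff: "i \<in> V \<Longrightarrow> j \<in> V \<Longrightarrow> a i = a j \<longleftrightarrow> i = j"
  using inj_a by (auto dest: inj_onD)

lemma b_eq_iff: "i \<in> V \<Longrightarrow> j \<in> V \<Longrightarrow> b i = b j \<longleftrightarrow> i = j"
  using inj_b by (auto dest: inj_onD)

lemma a_neq_b: "i \<in> V \<Longrightarrow> j \<in> V \<Longrightarrow> a i \<noteq> b j" "i \<in> V \<Longrightarrow> j \<in> V \<Longrightarrow> b i \<noteq> a j"
  using disjoint by (auto dest: sym)

lemma a_in: "i \<in> V \<Longrightarrow> a i \<in> X" and b_in: "i \<in> V \<Longrightarrow> b i \<in> X"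
  by (auto simp: X_eq)

definition support :: "'a set \<Rightarrow> 'i set" where
  "support B = {k \<in> V. a k \<in> B \<or> b k \<in> B}"

abbreviation vertex :: "'i \<Rightarrow> 'a \<times> 'a" where
  "vertex i \<equiv> (a i, b i)"

text \<open>A set \<open>R\<close> of 2-subsets of \<open>V\<close> stands for the edges of a graph on the vertices \<open>a\<^sub>ib\<^sub>i\<close>.\<close>

definition covers :: "('a set \<Rightarrow>\<^sub>0 int) \<Rightarrow> 'i set set \<Rightarrow> bool" where
  "covers f R \<longleftrightarrow> finite R \<and> Poly_Mapping.keys f \<subseteq> {B \<in> nsets X 3. support B \<in> R} \<and>
     has_volume f (2 * card R)"

text \<open>Kept apart from \<open>covers\<close> because it survives arbitrary sums, whereas
  volumes add only over disjoint edge sets.\<close>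

definition balanced :: "('a set \<Rightarrow>\<^sub>0 int) \<Rightarrow> bool" where
  "balanced f \<longleftrightarrow> (\<forall>A \<in> nsets X 2. block_degree X 3 A f = 0)"

lemma balanced_add: "balanced f \<Longrightarrow> balanced g \<Longrightarrow> balanced (f + g)"
  by (simp add: balanced_def block_degree_add)

lemma balanced_sum: "(\<And>i. i \<in> I \<Longrightarrow> balanced (f i)) \<Longrightarrow> balanced (sum f I)"
  by (simp add: balanced_def block_degree_sum)

lemma balanced_cycle_trade:
  assumes "C ! 0 = C ! (length C - 1)" "set C \<subseteq> V"
    "\<And>s. s < length C - 1 \<Longrightarrow> C ! s \<noteq> C ! Suc s"
  shows "balanced (cycle_trade (map vertex C))"
  unfolding balanced_def
proof
  fix A assume A: "A \<in> nsets X 2"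
  \<comment> \<open>The empty list is separate: there the truncated \<open>length C - 1\<close> is
    0, and index 0 is already out of range.\<close>
  show "block_degree X 3 A (cycle_trade (map vertex C)) = 0"
  proof (cases "C = []")
    case True
    then show ?thesis by (simp add: cycle_trade_def block_degree_zero)
  next
    case False
    then have nth: "map vertex C ! s = vertex (C ! s)" if "s \<le> length C - 1" for s
      using that \<open>C \<noteq> []\<close> by (intro nth_map) (simp add: Suc_le_eq less_Suc_eq_le flip: length_greater_0_conv)
    show ?thesis
    proof (rule block_degree_cycle_trade[OF finite_X A])
      show "map vertex C ! 0 = map vertex C ! (length (map vertex C) - 1)"
        using assms(1) by (simp add: nth)
    next
      fix s assume s: "s < length (map vertex C) - 1"
      then have "C ! s \<in> set C" "C ! Suc s \<in> set C"
        by (auto intro!: nth_mem)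
      then have "C ! s \<in> V" "C ! Suc s \<in> V" "C ! s \<noteq> C ! Suc s"
        using assms(2,3) s by auto
      then show "case (map vertex C ! s, map vertex C ! Suc s) of
          ((x, y), (z, w)) \<Rightarrow> {x, y, z, w} \<subseteq> X \<and> distinct [x, y, z, w]"
        using s by (simp add: nth a_in b_in a_eq_iff b_eq_iff a_neq_b)
    qed
  qed
qed

text \<open>Each block consists of one whole pair and one point of the other; as all points are
  distinct, no third index enters its support.\<close>

lemma covers_edge_term:
  assumes "i \<in> V" "j \<in> V" "i \<noteq> j"
  shows "covers (edge_term (vertex i) (vertex j)) {{i, j}}"
proof -
  let ?K = "{{a i, b i, a j}, {a i, b i, b j}, {a j, b j, a i}, {a j, b j, b i}}"
  have "?K \<subseteq> {B \<in> nsets X 3. support B \<in> {{i, j}}}"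
  proof -
    have "?K \<subseteq> nsets X 3"
      using assms by (simp add: nsets_3_insert a_in b_in a_eq_iff b_eq_iff a_neq_b)
    moreover have "support B = {i, j}" if "B \<in> ?K" for B
      using that assms by (auto simp: support_def a_eq_iff b_eq_iff a_neq_b)
    ultimately show ?thesis by blast
  qed
  then have "Poly_Mapping.keys (edge_term (vertex i) (vertex j)) \<subseteq>
      {B \<in> nsets X 3. support B \<in> {{i, j}}}"
    by (rule order.trans[OF keys_edge_term])
  moreover have "has_volume (edge_term (vertex i) (vertex j)) 2"
    using assms by (intro has_volume_edge_term) (simp add: a_eq_iff b_eq_iff a_neq_b)
  ultimately show ?thesis
    by (simp add: covers_def)
qed

text \<open>A block has only one support, so disjoint edge sets force disjoint key sets and volumes
  add.\<close>

lemma covers_add: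
  assumes "covers f R" "covers g S" "R \<inter> S = {}"
  shows "covers (f + g) (R \<union> S)"
proof -
  have "Poly_Mapping.keys f \<inter> Poly_Mapping.keys g = {}"
    using assms unfolding covers_def by blast
  then have "has_volume (f + g) (2 * card R + 2 * card S)"
    using assms by (intro has_volume_add) (auto simp: covers_def)
  moreover have "card (R \<union> S) = card R + card S"
    using assms by (intro card_Un_disjoint) (auto simp: covers_def)
  moreover have "Poly_Mapping.keys (f + g) \<subseteq> {B \<in> nsets X 3. support B \<in> R \<union> S}"
    using keys_add[of f g] assms(1,2) unfolding covers_def by blast
  ultimately show ?thesis
    using assms(1,2) by (simp add: covers_def)
qed

lemma covers_zero: "covers 0 {}"
  by (simp add: covers_def has_volume_iff)

lemma covers_sum:
  assumes "finite I" "\<And>i. i \<in> I \<Longrightarrow> covers (f i) (R i)" "disjoint_family_on R I"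
  shows "covers (sum f I) (\<Union>i\<in>I. R i)"
  using assms
proof (induction I)
  case empty
  show ?case by (simp add: covers_zero)
next
  case (insert i I)
  have "covers (f i + sum f I) (R i \<union> (\<Union>i\<in>I. R i))"
  proof (rule covers_add)
    show "covers (sum f I) (\<Union>i\<in>I. R i)"
      using insert by (intro insert.IH) (auto simp: disjoint_family_on_def)
    show "R i \<inter> (\<Union>i\<in>I. R i) = {}"
      using insert.prems(2) insert.hyps by (fastforce simp: disjoint_family_on_def)
  qed (use insert.prems in auto)
  then show ?case
    using insert.hyps by simp
qed

section \<open>Trades from triangles, 4-cycles, Steiner systems and matchings\<close>

lemma triangle_trade:
  assumes "{i, j, k} \<subseteq> V" "distinct [i, j, k]"
  shows "covers (cycle_trade [vertex i, vertex j, vertex k, vertex i]) (nsets {i, j, k} 2)"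
    and "balanced (cycle_trade [vertex i, vertex j, vertex k, vertex i])"
proof -
  have "covers (edge_term (vertex i) (vertex j) + edge_term (vertex j) (vertex k) +
      edge_term (vertex k) (vertex i)) ({{i, j}} \<union> {{j, k}} \<union> {{k, i}})"
    using assms by (intro covers_add covers_edge_term) (auto simp: doubleton_eq_iff)
  \<comment> \<open>A triangle uses all pairs of its vertices, which is the form in which the
    Steiner property speaks of blocks.\<close>
  moreover have "{{i, j}} \<union> {{j, k}} \<union> {{k, i}} = nsets {i, j, k} 2"
    using assms(2) by (auto simp: nsets_2_eq)
  ultimately show "covers (cycle_trade [vertex i, vertex j, vertex k, vertex i]) (nsets {i, j, k} 2)"
    by (simp add: cycle_trade_def numeral_3_eq_3 add.assoc)
  show "balanced (cycle_trade [vertex i, vertex j, vertex k, vertex i])"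
    by (rule balanced_cycle_trade[of "[i, j, k, i]", simplified list.map])
      (use assms in \<open>auto simp: less_Suc_eq\<close>)
qed

text \<open>The diagonals \<open>{i, k}\<close> and \<open>{j, l}\<close> stay uncovered. In part
  (ii) one diagonal joins the two extra vertices and belongs to the triangle; the other is a pair of
  Steiner vertices and is covered by a Steiner block.\<close>

lemma square_trade:
  assumes "{i, j, k, l} \<subseteq> V" "distinct [i, j, k, l]"
  shows "covers (cycle_trade [vertex i, vertex j, vertex k, vertex l, vertex i])
      {{i, j}, {j, k}, {k, l}, {l, i}}"
    and "balanced (cycle_trade [vertex i, vertex j, vertex k, vertex l, vertex i])"
proof -
  have "covers (edge_term (vertex i) (vertex j) + edge_term (vertex j) (vertex k) +
      edge_term (vertex k) (vertex l) + edge_term (vertex l) (vertex i))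
      ({{i, j}} \<union> {{j, k}} \<union> {{k, l}} \<union> {{l, i}})"
    using assms by (intro covers_add covers_edge_term) (auto simp: doubleton_eq_iff)
  then show "covers (cycle_trade [vertex i, vertex j, vertex k, vertex l, vertex i])
      {{i, j}, {j, k}, {k, l}, {l, i}}"
    by (simp add: cycle_trade_def numeral_eq_Suc add.assoc insert_commute)
  show "balanced (cycle_trade [vertex i, vertex j, vertex k, vertex l, vertex i])"
    by (rule balanced_cycle_trade[of "[i, j, k, l, i]", simplified list.map])
      (use assms in \<open>auto simp: less_Suc_eq\<close>)
qed

text \<open>The triangles of the blocks decompose the complete graph on \<open>J\<close>. Part (i)
  takes \<open>J = V\<close>; part (ii) leaves out two vertices.\<close>

lemma STS_trade:
  assumes "J \<subseteq> V" "is_STS m (a ` J) \<B>"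
    and "\<forall>B \<in> \<B>. \<beta>0 B \<in> J \<and> \<beta>1 B \<in> J \<and> \<beta>2 B \<in> J \<and> B = {a (\<beta>0 B), a (\<beta>1 B), a (\<beta>2 B)}"
  defines "h \<equiv> \<Sum>B \<in> \<B>. cycle_trade
      [vertex (\<beta>0 B), vertex (\<beta>1 B), vertex (\<beta>2 B), vertex (\<beta>0 B)]"
  shows "covers h (nsets J 2)" and "balanced h"
proof -
  define T where "T B = {\<beta>0 B, \<beta>1 B, \<beta>2 B}" for B
  have T: "T B \<subseteq> J" "B = a ` T B" if "B \<in> \<B>" for B
    using that assms(3) by (auto simp: T_def)
  have inj: "inj_on a J"
    using inj_a assms(1) by (rule inj_on_subset)
  \<comment> \<open>The Steiner property, transported from points to indices by injectivity of
    \<open>a\<close> on \<open>J\<close>.\<close>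
  have unique: "\<exists>!B. B \<in> \<B> \<and> P \<subseteq> T B" if "P \<in> nsets J 2" for P
  proof -
    have P: "P \<subseteq> J" "card P = 2" "finite P"
      using that by (auto simp: nsets_def)
    have "a ` P \<in> nsets (a ` J) 2"
      using P inj by (auto simp: nsets_def card_image inj_on_subset)
    then have "\<exists>!B. B \<in> \<B> \<and> a ` P \<subseteq> B"
      using assms(2) by (simp add: is_STS_def)
    moreover have "a ` P \<subseteq> B \<longleftrightarrow> P \<subseteq> T B" if "B \<in> \<B>" for B
    proof -
      have "a ` P \<subseteq> a ` T B \<longleftrightarrow> P \<subseteq> T B"
        using T(1)[OF that] P(1) inj by (blast dest: inj_onD)
      then show ?thesis
        using T(2)[OF that] by simp
    qed
    ultimately show ?thesis
      by (metis (no_types, lifting))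
  qed
  have "finite \<B>"
    using assms(2) by (auto simp: is_STS_def intro: finite_subset finite_imp_finite_nsets)
  \<comment> \<open>Distinctness of the listed indices follows from the block having three
    points.\<close>
  have tri: "{\<beta>0 B, \<beta>1 B, \<beta>2 B} \<subseteq> V" "distinct [\<beta>0 B, \<beta>1 B, \<beta>2 B]" if "B \<in> \<B>" for B
  proof -
    have "card (a ` T B) = 3"
      using assms(2) that T(2)[OF that] by (auto simp: is_STS_def nsets_def)
    then have "card (T B) = 3"
      using T(1)[OF that] inj by (simp add: card_image inj_on_subset)
    then show "distinct [\<beta>0 B, \<beta>1 B, \<beta>2 B]"
      by (auto simp: T_def card_insert_if split: if_splits)
    show "{\<beta>0 B, \<beta>1 B, \<beta>2 B} \<subseteq> V"
      using T(1)[OF that] assms(1) by (auto simp: T_def)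
  qed
  \<comment> \<open>Existence of a block through each pair gives the covering here; its uniqueness
    gives the disjointness below.\<close>
  have "(\<Union>B\<in>\<B>. nsets (T B) 2) = nsets J 2"
  proof
    show "(\<Union>B\<in>\<B>. nsets (T B) 2) \<subseteq> nsets J 2"
      using T(1) by (fastforce simp: nsets_def)
    show "nsets J 2 \<subseteq> (\<Union>B\<in>\<B>. nsets (T B) 2)"
    proof
      fix P assume P: "P \<in> nsets J 2"
      then obtain B where "B \<in> \<B>" "P \<subseteq> T B"
        using unique by blast
      then show "P \<in> (\<Union>B\<in>\<B>. nsets (T B) 2)"
        using P by (auto simp: nsets_def)
    qed
  qed
  moreover have "disjoint_family_on (\<lambda>B. nsets (T B) 2) \<B>"
    unfolding disjoint_family_on_def
  proof (intro ballI impI equals0I)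
    fix B B' P assume *: "B \<in> \<B>" "B' \<in> \<B>" "B \<noteq> B'" "P \<in> nsets (T B) 2 \<inter> nsets (T B') 2"
    then have "P \<in> nsets J 2" "P \<subseteq> T B" "P \<subseteq> T B'"
      using T(1) by (fastforce simp: nsets_def)+
    then show False
      using unique * by blast
  qed
  ultimately show "covers h (nsets J 2)"
    unfolding h_def using covers_sum[of \<B> _ "\<lambda>B. nsets (T B) 2"] triangle_trade(1)[OF tri] \<open>finite \<B>\<close>
    by (simp add: T_def)
  show "balanced h"
    unfolding h_def using triangle_trade(2)[OF tri] by (rule balanced_sum)
qed

text \<open>The 4-cycle of a matched pair is the complete bipartite graph between that pair and
  \<open>{y, z}\<close>. As the pairs partition \<open>K\<close>, these graphs partition the edges
  between \<open>K\<close> and \<open>{y, z}\<close>.\<close>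

lemma matching_trade:
  assumes "K \<subseteq> V" "y \<in> V - K" "z \<in> V - K" "y \<noteq> z" "partition_on (a ` K) S"
    and "\<forall>P \<in> S. card P = 2 \<and> i P \<in> K \<and> j P \<in> K \<and> P = {a (i P), a (j P)}"
  defines "h \<equiv> \<Sum>P \<in> S. cycle_trade
      [vertex y, vertex (i P), vertex z, vertex (j P), vertex y]"
  shows "covers h (join K {y, z})" and "balanced h"
proof -
  have "finite S"
    using assms(1,5) finite_V by (meson finite_elements finite_imageI finite_subset)
  have neq: "i P \<noteq> j P" if "P \<in> S" for P
    using assms(6) that by (metis card_2_iff doubleton_eq_iff insert_absorb2)
  have mem: "a k \<in> P" if "P \<in> S" "k \<in> {i P, j P}" for P k
  proof -
    have "a k \<in> {a (i P), a (j P)}"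
      using that(2) by auto
    also have "\<dots> = P"
      using assms(6) that(1) by metis
    finally show ?thesis .
  qed
  have square: "{y, i P, z, j P} \<subseteq> V" "distinct [y, i P, z, j P]" if "P \<in> S" for P
    using assms(1-4,6) that neq[OF that] by auto
  have inj: "inj_on a K"
    using inj_a assms(1) by (rule inj_on_subset)
  have join_eq: "{{y, i P}, {i P, z}, {z, j P}, {j P, y}} = join {i P, j P} {y, z}" for P
    by (auto simp: join_def)
  have "K = (\<Union>P\<in>S. {i P, j P})"
  proof
    show "K \<subseteq> (\<Union>P\<in>S. {i P, j P})"
    proof
      fix k assume "k \<in> K"
      then obtain P where "P \<in> S" "a k \<in> P"
        using assms(5) by (auto simp: partition_on_def)
      then show "k \<in> (\<Union>P\<in>S. {i P, j P})"
        using assms(6) inj \<open>k \<in> K\<close> by (metis UN_I inj_onD insert_iff singletonD)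
    qed
  qed (use assms(6) in auto)
  then have "(\<Union>P\<in>S. join {i P, j P} {y, z}) = join K {y, z}"
    by (auto simp: join_def)
  moreover have "disjoint_family_on (\<lambda>P. join {i P, j P} {y, z}) S"
    unfolding disjoint_family_on_def
  proof (intro ballI impI equals0I)
    fix P Q E assume *: "P \<in> S" "Q \<in> S" "P \<noteq> Q" "E \<in> join {i P, j P} {y, z} \<inter> join {i Q, j Q} {y, z}"
    \<comment> \<open>One end of \<open>E\<close> is \<open>y\<close> or \<open>z\<close>, which lie
      outside \<open>K\<close>; its other end is therefore an index common to both pairs.\<close>
    then have "{i P, j P} \<inter> {i Q, j Q} \<noteq> {}"
      using square[of P] square[of Q] by (auto simp: join_def doubleton_eq_iff)
    then have "P \<inter> Q \<noteq> {}"
      using mem *(1,2) by blast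
    then show False
      using * assms(5) by (auto simp: partition_on_def disjoint_def)
  qed
  ultimately show "covers h (join K {y, z})"
    unfolding h_def using covers_sum[of S _ "\<lambda>P. join {i P, j P} {y, z}"]
      square_trade(1)[OF square, unfolded join_eq] \<open>finite S\<close> by simp
  show "balanced h"
    unfolding h_def using square_trade(2)[OF square] by (rule balanced_sum)
qed

section \<open>From decompositions of the complete graph to the two trades\<close>

lemma trade_if_covers_all:
  assumes "covers f (nsets V 2)" "balanced f" "card V = 2 * n + 1" "n > 0"
  shows "is_trade 2 3 (4 * n + 2) X f \<and> has_volume f (2 * ((2 * n + 1) choose 2))"
proof -
  have "card X = 4 * n + 2"
    using finite_V inj_a inj_b disjoint assms(3) by (simp add: X_eq card_Un_disjoint card_image)
  moreover have "card (nsets V 2) = (2 * n + 1) choose 2"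
    by (simp add: assms(3) card_nsets)
  \<comment> \<open>Positivity of \<open>n\<close> gives the size condition
    \<open>3 + 2 \<le> 4 * n + 2\<close>.\<close>
  ultimately show ?thesis
    using assms(1,2,4) finite_X by (auto simp: is_trade_iff covers_def balanced_def)
qed

end

theorem theorem2p2:
  fixes n :: nat and X :: "'a set" and a b :: "nat \<Rightarrow> 'a"
  assumes "n > 0"
    and "finite X" and "card X = 4 * n + 2"
    and "inj_on a {0..2 * n}" and "inj_on b {0..2 * n}"
    and "a ` {0..2 * n} \<inter> b ` {0..2 * n} = {}"
    and "X = a ` {0..2 * n} \<union> b ` {0..2 * n}"
  shows
    "(\<forall>\<B> \<beta>0 \<beta>1 \<beta>2.
        (2 * n + 1) mod 6 \<in> {1, 3} \<and>
        is_STS (2 * n + 1) (a ` {0..2 * n}) \<B> \<and>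
        (\<forall>B \<in> \<B>. \<beta>0 B \<in> {0..2 * n} \<and> \<beta>1 B \<in> {0..2 * n} \<and> \<beta>2 B \<in> {0..2 * n} \<and>
                  B = {a (\<beta>0 B), a (\<beta>1 B), a (\<beta>2 B)}) \<longrightarrow>
        (let h1 = (\<Sum>B \<in> \<B>. cycle_trade
                    [(a (\<beta>0 B), b (\<beta>0 B)), (a (\<beta>1 B), b (\<beta>1 B)),
                     (a (\<beta>2 B), b (\<beta>2 B)), (a (\<beta>0 B), b (\<beta>0 B))])
         in is_trade 2 3 (4 * n + 2) X h1 \<and> has_volume h1 (2 * ((2 * n + 1) choose 2))))
     \<and>
     (\<forall>\<B> \<beta>0 \<beta>1 \<beta>2 S i j.
        (2 * n + 1) mod 6 = 5 \<and>
        is_STS (2 * n - 1) (a ` {0..2 * n - 2}) \<B> \<and>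
        (\<forall>B \<in> \<B>. \<beta>0 B \<in> {0..2 * n - 2} \<and> \<beta>1 B \<in> {0..2 * n - 2} \<and> \<beta>2 B \<in> {0..2 * n - 2} \<and>
                  B = {a (\<beta>0 B), a (\<beta>1 B), a (\<beta>2 B)}) \<and>
        partition_on (a ` {0..2 * n - 3}) S \<and>
        (\<forall>P \<in> S. card P = 2 \<and> i P \<in> {0..2 * n - 3} \<and> j P \<in> {0..2 * n - 3} \<and>
                  P = {a (i P), a (j P)}) \<longrightarrow>
        (let h2 = (\<Sum>B \<in> \<B>. cycle_trade
                    [(a (\<beta>0 B), b (\<beta>0 B)), (a (\<beta>1 B), b (\<beta>1 B)),
                     (a (\<beta>2 B), b (\<beta>2 B)), (a (\<beta>0 B), b (\<beta>0 B))])
                + cycle_trade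
                    [(a (2 * n - 2), b (2 * n - 2)), (a (2 * n - 1), b (2 * n - 1)),
                     (a (2 * n), b (2 * n)), (a (2 * n - 2), b (2 * n - 2))]
                + (\<Sum>P \<in> S. cycle_trade
                    [(a (2 * n - 1), b (2 * n - 1)), (a (i P), b (i P)),
                     (a (2 * n), b (2 * n)), (a (j P), b (j P)),
                     (a (2 * n - 1), b (2 * n - 1))])
         in is_trade 2 3 (4 * n + 2) X h2 \<and> has_volume h2 (2 * ((2 * n + 1) choose 2))))"
proof -
  interpret paired_points a b "{0..2 * n}" X
    using assms by unfold_locales auto
  show ?thesis
  proof (intro conjI allI impI; elim conjE; unfold Let_def)
    fix \<B> \<beta>0 \<beta>1 \<beta>2
    assume "is_STS (2 * n + 1) (a ` {0..2 * n}) \<B>"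
      and "\<forall>B \<in> \<B>. \<beta>0 B \<in> {0..2 * n} \<and> \<beta>1 B \<in> {0..2 * n} \<and> \<beta>2 B \<in> {0..2 * n} \<and>
                  B = {a (\<beta>0 B), a (\<beta>1 B), a (\<beta>2 B)}"
    note STS = STS_trade[OF subset_refl this]
    show "is_trade 2 3 (4 * n + 2) X (\<Sum>B \<in> \<B>. cycle_trade
                    [(a (\<beta>0 B), b (\<beta>0 B)), (a (\<beta>1 B), b (\<beta>1 B)),
                     (a (\<beta>2 B), b (\<beta>2 B)), (a (\<beta>0 B), b (\<beta>0 B))]) \<and>
        has_volume (\<Sum>B \<in> \<B>. cycle_trade
                    [(a (\<beta>0 B), b (\<beta>0 B)), (a (\<beta>1 B), b (\<beta>1 B)),
                     (a (\<beta>2 B), b (\<beta>2 B)), (a (\<beta>0 B), b (\<beta>0 B))])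
          (2 * ((2 * n + 1) choose 2))"
      by (rule trade_if_covers_all[OF STS]) (use assms(1) in simp_all)
  next
    fix \<B> \<beta>0 \<beta>1 \<beta>2 S i j
    assume mod5: "(2 * n + 1) mod 6 = 5"
      and STS: "is_STS (2 * n - 1) (a ` {0..2 * n - 2}) \<B>"
        "\<forall>B \<in> \<B>. \<beta>0 B \<in> {0..2 * n - 2} \<and> \<beta>1 B \<in> {0..2 * n - 2} \<and> \<beta>2 B \<in> {0..2 * n - 2} \<and>
                  B = {a (\<beta>0 B), a (\<beta>1 B), a (\<beta>2 B)}"
      and S: "partition_on (a ` {0..2 * n - 3}) S"
        "\<forall>P \<in> S. card P = 2 \<and> i P \<in> {0..2 * n - 3} \<and> j P \<in> {0..2 * n - 3} \<and>
                  P = {a (i P), a (j P)}"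
    \<comment> \<open>For \<open>n = 1\<close> the residue would be 3. The bound makes the
      subtractions in \<open>2 * n - 2\<close> and \<open>2 * n - 3\<close> genuine, so that
      \<open>?x\<close> lies outside \<open>{0..2 * n - 3}\<close>.\<close>
    have "n \<ge> 2"
      using mod5 by (cases "n = 1") (use assms(1) in auto)
    let ?x = "2 * n - 2" and ?y = "2 * n - 1" and ?z = "2 * n"
    have V: "{0..2 * n} = insert ?y (insert ?z (insert ?x {0..2 * n - 3}))"
      "{0..2 * n - 2} = insert ?x {0..2 * n - 3}"
      using \<open>n \<ge> 2\<close> by auto
    have sub: "{0..2 * n - 2} \<subseteq> {0..2 * n}" "{0..2 * n - 3} \<subseteq> {0..2 * n}"
      "?y \<in> {0..2 * n} - {0..2 * n - 3}" "?z \<in> {0..2 * n} - {0..2 * n - 3}" "?y \<noteq> ?z"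
      "{?x, ?y, ?z} \<subseteq> {0..2 * n}" "distinct [?x, ?y, ?z]"
      "{?x, ?y, ?z} \<inter> {0..2 * n - 3} = {}"
      using \<open>n \<ge> 2\<close> by auto
    note blocks = STS_trade[OF sub(1) STS]
      and triangle = triangle_trade[OF sub(6,7)]
      and squares = matching_trade[OF sub(2-5) S]
    note edges = nsets_2_insert3[OF sub(8,7), folded V]
    show "is_trade 2 3 (4 * n + 2) X ((\<Sum>B \<in> \<B>. cycle_trade
                    [(a (\<beta>0 B), b (\<beta>0 B)), (a (\<beta>1 B), b (\<beta>1 B)),
                     (a (\<beta>2 B), b (\<beta>2 B)), (a (\<beta>0 B), b (\<beta>0 B))])
                + cycle_trade [(a ?x, b ?x), (a ?y, b ?y), (a ?z, b ?z), (a ?x, b ?x)]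
                + (\<Sum>P \<in> S. cycle_trade
                    [(a ?y, b ?y), (a (i P), b (i P)), (a ?z, b ?z), (a (j P), b (j P)),
                     (a ?y, b ?y)])) \<and>
        has_volume ((\<Sum>B \<in> \<B>. cycle_trade
                    [(a (\<beta>0 B), b (\<beta>0 B)), (a (\<beta>1 B), b (\<beta>1 B)),
                     (a (\<beta>2 B), b (\<beta>2 B)), (a (\<beta>0 B), b (\<beta>0 B))])
                + cycle_trade [(a ?x, b ?x), (a ?y, b ?y), (a ?z, b ?z), (a ?x, b ?x)]
                + (\<Sum>P \<in> S. cycle_trade
                    [(a ?y, b ?y), (a (i P), b (i P)), (a ?z, b ?z), (a (j P), b (j P)),
                     (a ?y, b ?y)]))
          (2 * ((2 * n + 1) choose 2))" (is "is_trade _ _ _ _ ?h \<and> has_volume ?h _")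
    proof (rule trade_if_covers_all)
      \<comment> \<open>The order of the union in \<open>edges(3)\<close> matches the order of the
        summands, so \<open>edges(1,2)\<close> are exactly the disjointness goals of the two nested
        uses of \<open>covers_add\<close>.\<close>
      show "covers ?h (nsets {0..2 * n} 2)"
        unfolding edges(3) by (intro covers_add blocks triangle squares edges(1,2))
      show "balanced ?h"
        by (intro balanced_add blocks triangle squares)
    qed (use assms(1) in simp_all)
  qed
qed

end
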